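(* Let $p\in(0,1)$. Put $\lambda^\circ_p:=-\ln(1-p)$ and $$\lambda^*_p:=\min(\lambda^\circ_p,1)=\begin{cases}\lambda^\circ_p&\text{if }p\le 1-e^{-1},\\ 1&\text{if }p\ge 1-e^{-1}.\end{cases}$$ Then $d_{\mathsf{TV}}(X_{1,p},\Pi_\lambda)$ is strictly decreasing in $\lambda\in(0,\lambda^*_p]$ and strictly increasing in $\lambda\in[\lambda^*_p,\infty)$. Hence, $$\min_{\lambda>0}d_{\mathsf{TV}}(X_{1,p},\Pi_\lambda)=d_{\mathsf{TV}}(X_{1,p},\Pi_{\lambda^*_p})=\min\big[d_{\mathsf{TV}}(X_{1,p},\Pi_{\lambda^\circ_p}),\,d_{\mathsf{TV}}(X_{1,p},\Pi_1)\big]=\begin{cases}p+(1-p)\ln(1-p)&\text{if }p\le 1-e^{-1},\\ p-e^{-1}&\text{if }p\ge 1-e^{-1}.\end{cases}$$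
   Context: $X_{n,p}$ denotes a random variable having the binomial distribution with parameters $n$ and $p$ (so $X_{1,p}$ is Bernoulli with parameter $p$). For real $\lambda>0$, $\Pi_\lambda$ denotes a random variable having the Poisson distribution with parameter $\lambda$. The total variation distance is $d_{\mathsf{TV}}(X,Y):=\sup_{A}|\mathsf P(X\in A)-\mathsf P(Y\in A)|$, the supremum being over all Borel subsets $A$ of $\mathbb R$. *)

theory Defs
  imports "HOL-Probability.Probability"
begin

text \<open>The two random variables may live on different probability spaces.  For random variables
  on probability spaces the supremum is over a nonempty set bounded by 1.\<close>

definition tv_dist :: "'a measure \<Rightarrow> ('a \<Rightarrow> real) \<Rightarrow> 'b measure \<Rightarrow> ('b \<Rightarrow> real) \<Rightarrow> real" where
  "tv_dist M X N Y =
     (SUP A\<in>sets (borel :: real measure). \<bar>\<P>(x in M. X x \<in> A) - \<P>(y in N. Y y \<in> A)\<bar>)"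

text \<open>The law on the naturals is pushed forward to the Borel sets of the reals.\<close>

definition has_nat_law :: "'a measure \<Rightarrow> ('a \<Rightarrow> real) \<Rightarrow> nat pmf \<Rightarrow> bool" where
  "has_nat_law M X q \<longleftrightarrow>
     prob_space M \<and> X \<in> borel_measurable M \<and> distr M borel X = distr (measure_pmf q) borel real"

lemma has_nat_law_canonical: "has_nat_law (measure_pmf q) real q"
  by (simp add: has_nat_law_def prob_space_measure_pmf)

definition lambda_circ :: "real \<Rightarrow> real" where
  "lambda_circ p = - ln (1 - p)"

definition lambda_star :: "real \<Rightarrow> real" where
  "lambda_star p = min (lambda_circ p) 1"

end

theory Submission
  imports Defs
begin

text \<open>The only atoms at which the Bernoulli law can exceed the Poisson law are 0 and 1, so the
  distance is \<open>max 0 (1 - p - exp (-l)) + max 0 (p - l * exp (-l))\<close>. The first term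
  vanishes for \<open>l \<le> lambda_circ p\<close>, and there \<open>l * exp (-l) \<le> 1 - exp (-l) \<le> p\<close>, so the
  distance equals \<open>p - l * exp (-l)\<close>, which has its minimum at \<open>l = 1\<close>. For \<open>l \<ge> lambda_circ p\<close>
  it is the maximum of the increasing functions \<open>1 - p - exp (-l)\<close> and
  \<open>1 - (1 + l) * exp (-l)\<close>.\<close>

lemma prob_has_nat_law:
  assumes "has_nat_law M X q" and "A \<in> sets borel"
  shows "\<P>(x in M. X x \<in> A) = measure_pmf.prob q (real -` A)"
proof -
  have X: "X \<in> borel_measurable M" and eq: "distr M borel X = distr (measure_pmf q) borel real"
    using assms(1) by (auto simp: has_nat_law_def)
  have "\<P>(x in M. X x \<in> A) = measure (distr M borel X) A"
    using X assms(2) by (simp add: measure_distr vimage_def Int_def conj_commute)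
  also have "\<dots> = measure_pmf.prob q (real -` A)"
    unfolding eq using assms(2) by (simp add: measure_distr)
  finally show ?thesis .
qed

lemma prob_split_01:
  fixes q :: "nat pmf"
  shows "measure_pmf.prob q B = indicator B 0 * pmf q 0 + indicator B 1 * pmf q 1
    + measure_pmf.prob q (B - {0, 1})"
proof -
  have "measure_pmf.prob q B = measure_pmf.prob q (B \<inter> {0, 1}) + measure_pmf.prob q (B - {0, 1})"
    by (subst measure_pmf.finite_measure_Union[symmetric])
      (auto intro!: arg_cong[where f = "measure_pmf.prob q"])
  moreover have "measure_pmf.prob q (B \<inter> {0, 1}) = sum (pmf q) (B \<inter> {0, 1})"
    by (intro measure_measure_pmf_finite) simp
  moreover have "sum (pmf q) (B \<inter> {0, 1}) = indicator B 0 * pmf q 0 + indicator B 1 * pmf q 1"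
    by (simp add: Int_insert_right indicator_def)
  ultimately show ?thesis by simp
qed

text \<open>With \<open>x\<close>, \<open>y\<close> the excesses of \<open>q\<close> over
  \<open>r\<close> at 0 and 1, the difference of the probabilities of \<open>A\<close> is a sub-sum
  of \<open>x\<close>, \<open>y\<close> minus the mass \<open>R\<close> that \<open>r\<close> gives
  to \<open>A\<close> off {0, 1}. Since \<open>0 \<le> R \<le> x + y\<close>, its absolute value is
  at most the sum of the positive parts, and the set of atoms with positive excess attains
  this.\<close>

lemma tv_dist_supported_01:
  assumes X: "has_nat_law M X q" and Y: "has_nat_law N Y r"
    and supp: "set_pmf q \<subseteq> {0, 1}"
  shows "tv_dist M X N Y = max 0 (pmf q 0 - pmf r 0) + max 0 (pmf q 1 - pmf r 1)"
proof -
  define x where "x = pmf q 0 - pmf r 0"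
  define y where "y = pmf q 1 - pmf r 1"
  have q0: "measure_pmf.prob q (B - {0, 1}) = 0" for B
    using supp by (subst measure_pmf_zero_iff) auto
  have diff: "\<P>(x in M. X x \<in> A) - \<P>(y in N. Y y \<in> A)
      = indicator A 0 * x + indicator A 1 * y - measure_pmf.prob r (real -` A - {0, 1})"
    if "A \<in> sets borel" for A
    unfolding prob_has_nat_law[OF X that] prob_has_nat_law[OF Y that]
      prob_split_01[of q "real -` A"] prob_split_01[of r "real -` A"] q0
    by (simp add: x_def y_def indicator_def algebra_simps)
  \<comment> \<open>Both laws have total mass 1, so what \<open>r\<close> lacks on {0, 1} compared
    with \<open>q\<close> lies elsewhere. This gives the bound from below on the signed
    difference.\<close>
  have xy: "measure_pmf.prob r (UNIV - {0, 1}) = x + y"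
    using prob_split_01[of q UNIV] prob_split_01[of r UNIV] q0[of UNIV]
    by (simp add: x_def y_def)
  have upper: "\<bar>\<P>(x in M. X x \<in> A) - \<P>(y in N. Y y \<in> A)\<bar> \<le> max 0 x + max 0 y"
    if "A \<in> sets borel" for A
  proof -
    define R where "R = measure_pmf.prob r (real -` A - {0, 1})"
    have "R \<le> x + y" "0 \<le> R"
      unfolding xy[symmetric] R_def by (auto intro: measure_pmf.finite_measure_mono)
    then show ?thesis
      unfolding diff[OF that] R_def[symmetric] by (auto simp: indicator_def max_def)
  qed
  define A where "A = (if x > 0 then {0} else {}) \<union> (if y > 0 then {1 :: real} else {})"
  have A: "A \<in> sets borel"
    by (simp add: A_def)
  have "real -` A - {0, 1} = {}"
    by (auto simp: A_def split: if_splits)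
  then have A_tail: "measure_pmf.prob r (real -` A - {0, 1}) = 0"
    by (simp only: measure_empty)
  have attained: "\<bar>\<P>(x in M. X x \<in> A) - \<P>(y in N. Y y \<in> A)\<bar> = max 0 x + max 0 y"
    unfolding diff[OF A] A_tail by (simp add: A_def indicator_def)
  show ?thesis
    unfolding tv_dist_def x_def[symmetric] y_def[symmetric]
    by (rule cSup_eq_maximum) (use A attained upper in force)+
qed

lemma tv_dist_bernoulli_poisson:
  assumes "0 < p" "p < 1" "0 < l"
    and "has_nat_law M X (binomial_pmf 1 p)" and "has_nat_law N Y (poisson_pmf l)"
  shows "tv_dist M X N Y = max 0 (1 - p - exp (-l)) + max 0 (p - l * exp (-l))"
proof -
  have "set_pmf (binomial_pmf 1 p) \<subseteq> {0, 1}"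
    using assms by (auto simp: set_pmf_binomial)
  from tv_dist_supported_01[OF assms(4,5) this] show ?thesis
    using assms by (simp add: mult.commute)
qed

lemma DERIV_mult_exp_minus:
  fixes x :: real
  shows "((\<lambda>x. x * exp (-x)) has_real_derivative (1 - x) * exp (-x)) (at x)"
  by (auto intro!: derivative_eq_intros simp: algebra_simps)

text \<open>The derivative \<open>(1 - x) * exp (-x)\<close> changes sign at 1. Its sign is needed
  only inside the interval, so the endpoint 1, where it vanishes, may be included here and in the
  decreasing counterpart.\<close>

lemma mult_exp_minus_less:
  fixes a b :: real
  assumes "a < b" "b \<le> 1"
  shows "a * exp (-a) < b * exp (-b)"
  by (rule DERIV_pos_imp_increasing_open[OF assms(1)])
    (use assms(2) in \<open>auto intro!: exI conjI DERIV_mult_exp_minus continuous_intros\<close>)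

lemma mult_exp_minus_greater:
  fixes a b :: real
  assumes "a < b" "1 \<le> a"
  shows "b * exp (-b) < a * exp (-a)"
  by (rule DERIV_neg_imp_decreasing_open[OF assms(1)])
    (use assms(2) in \<open>auto intro!: exI conjI DERIV_mult_exp_minus continuous_intros
      simp: mult_less_0_iff\<close>)

theorem proposition1:
  fixes p :: real
    and M :: "'a measure" and X :: "'a \<Rightarrow> real"
    and N :: "real \<Rightarrow> 'b measure" and Y :: "real \<Rightarrow> 'b \<Rightarrow> real"
  assumes "0 < p" and "p < 1"
    and "has_nat_law M X (binomial_pmf 1 p)"
    and "\<And>l. 0 < l \<Longrightarrow> has_nat_law (N l) (Y l) (poisson_pmf l)"
  shows "let D = (\<lambda>l. tv_dist M X (N l) (Y l)) in
      (p \<le> 1 - exp (-1) \<longrightarrow> lambda_star p = lambda_circ p) \<and>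
      (p \<ge> 1 - exp (-1) \<longrightarrow> lambda_star p = 1) \<and>
      strict_antimono_on {0<..lambda_star p} D \<and>
      strict_mono_on {lambda_star p..} D \<and>
      is_arg_min D (\<lambda>l. 0 < l) (lambda_star p) \<and>
      D (lambda_star p) = min (D (lambda_circ p)) (D 1) \<and>
      (p \<le> 1 - exp (-1) \<longrightarrow> D (lambda_star p) = p + (1 - p) * ln (1 - p)) \<and>
      (p \<ge> 1 - exp (-1) \<longrightarrow> D (lambda_star p) = p - exp (-1))"
proof -
  define D where "D = (\<lambda>l. tv_dist M X (N l) (Y l))"
  define c where "c = lambda_circ p"
  define s where "s = lambda_star p"
  have s: "s = min c 1"
    by (simp add: s_def c_def lambda_star_def)
  have exp_c: "exp (-c) = 1 - p"
    using assms by (simp add: c_def lambda_circ_def)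
  have c_pos: "0 < c"
    using assms by (simp add: c_def lambda_circ_def)
  have s_pos: "0 < s"
    using c_pos by (simp add: s)
  have c_le_1: "c \<le> 1 \<longleftrightarrow> p \<le> 1 - exp (-1)"
    using exp_c exp_le_cancel_iff[of "-1" "-c"] by linarith
  have one_le_c: "1 \<le> c \<longleftrightarrow> 1 - exp (-1) \<le> p"
    using exp_c exp_le_cancel_iff[of "-c" "-1"] by linarith
  have D: "D l = max 0 (1 - p - exp (-l)) + max 0 (p - l * exp (-l))" if "0 < l" for l
    unfolding D_def using tv_dist_bernoulli_poisson assms that by blast
  have D_low: "D l = p - l * exp (-l)" if "0 < l" "l \<le> c" for l
  proof -
    have "1 - p \<le> exp (-l)"
      using that exp_c exp_le_cancel_iff[of "-c" "-l"] by linarith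
    moreover have "l * exp (-l) \<le> 1 - exp (-l)"
    proof -
      \<comment> \<open>This is \<open>1 + l \<le> exp l\<close> scaled by \<open>exp (-l)\<close>;
        the right-hand side is 1.\<close>
      have "(1 + l) * exp (-l) \<le> exp l * exp (-l)"
        using exp_ge_add_one_self[of l] by (intro mult_right_mono) auto
      then show ?thesis
        by (simp add: exp_minus algebra_simps)
    qed
    ultimately show ?thesis
      using D[OF that(1)] by linarith
  qed
  \<comment> \<open>Here \<open>u = 1 - p - exp (-l)\<close> is nonnegative, so with
    \<open>v = p - l * exp (-l)\<close> the distance is \<open>u + max 0 v = max u (u + v)\<close>,
    and \<open>p\<close> cancels in \<open>u + v\<close>.\<close>
  have D_high: "D l = max (1 - p - exp (-l)) (1 - exp (-l) - l * exp (-l))" if "c \<le> l" for l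
  proof -
    have "exp (-l) \<le> 1 - p"
      using that exp_c exp_le_cancel_iff[of "-l" "-c"] by linarith
    then show ?thesis
      using D[of l] c_pos that by linarith
  qed
  have decreasing: "D b < D a" if "0 < a" "a < b" "b \<le> s" for a b
    using that mult_exp_minus_less[of a b] D_low[of a] D_low[of b] s by force
  \<comment> \<open>The assumptions give \<open>s < c\<close>, hence \<open>s = 1\<close>, so
    \<open>a\<close> and \<open>b\<close> lie where \<open>x * exp (-x)\<close> decreases.\<close>
  have increasing_low: "D a < D b" if "s \<le> a" "a < b" "b \<le> c" for a b
    using that mult_exp_minus_greater[of a b] D_low[of a] D_low[of b] s s_pos by force
  have increasing_high: "D a < D b" if "c \<le> a" "a < b" for a b
  proof -
    have "exp (-b) < exp (-a)"
      using that by simp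
    moreover have "(1 + b) * exp (-b) < (1 + a) * exp (-a)"
    proof -
      \<comment> \<open>Up to the factor \<open>exp 1\<close>, \<open>(1 + l) * exp (-l)\<close> is
        \<open>x * exp (-x)\<close> at \<open>x = 1 + l\<close>, and this \<open>x\<close> is beyond
        the maximum point 1.\<close>
      have "(1 + b) * exp (-(1 + b)) < (1 + a) * exp (-(1 + a))"
        using that c_pos by (intro mult_exp_minus_greater) auto
      then have "exp 1 * ((1 + b) * exp (-(1 + b))) < exp 1 * ((1 + a) * exp (-(1 + a)))"
        by (intro mult_strict_left_mono) auto
      moreover have "exp 1 * ((1 + x) * exp (-(1 + x))) = (1 + x) * exp (-x)" for x :: real
        by (simp add: mult.left_commute[of "exp 1"] flip: exp_add)
      ultimately show ?thesis
        by (simp only:)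
    qed
    moreover have "c \<le> b"
      using that by simp
    ultimately show ?thesis
      unfolding D_high[OF that(1)] D_high[OF \<open>c \<le> b\<close>] distrib_right mult_1 by linarith
  qed
  \<comment> \<open>If \<open>c\<close> lies strictly between \<open>a\<close> and \<open>b\<close>,
    the two ranges are chained through \<open>D c\<close>.\<close>
  have increasing: "D a < D b" if "s \<le> a" "a < b" for a b
    using increasing_low[of a b] increasing_low[of a c] increasing_high[of a b]
      increasing_high[of c b] that by (cases "b \<le> c"; cases "c \<le> a"; force)
  have minimal: "D s \<le> D l" if "0 < l" for l
    using decreasing[of l s] increasing[of s l] that by (cases l s rule: linorder_cases) auto
  \<comment> \<open>\<open>s\<close> is one of \<open>c\<close> and 1, and by minimality
    \<open>D s\<close> exceeds neither value.\<close>
  have "D s = min (D c) (D 1)"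
    using minimal[of c] minimal[of 1] c_pos s by (auto simp: min_def)
  moreover have "D s = p + (1 - p) * ln (1 - p)" if "p \<le> 1 - exp (-1)"
  proof -
    have "s = c"
      using that c_le_1 s by simp
    then have "D s = p - c * (1 - p)"
      using D_low[of c] c_pos exp_c by simp
    then show ?thesis
      by (simp add: c_def lambda_circ_def mult.commute)
  qed
  moreover have "D s = p - exp (-1)" if "p \<ge> 1 - exp (-1)"
    using that one_le_c s D_low[of 1] by simp
  moreover have "strict_antimono_on {0<..s} D"
    by (auto intro!: monotone_onI decreasing)
  moreover have "strict_mono_on {s..} D"
    by (auto intro!: strict_mono_onI increasing)
  moreover have "is_arg_min D (\<lambda>l. 0 < l) s"
    using s_pos minimal by (auto simp: is_arg_min_linorder)
  moreover have "p \<le> 1 - exp (-1) \<longrightarrow> s = c" and "p \<ge> 1 - exp (-1) \<longrightarrow> s = 1"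
    using c_le_1 one_le_c s by auto
  ultimately show ?thesis
    unfolding Let_def D_def[symmetric] c_def[symmetric] s_def[symmetric] by blast
qed

end
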